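(* Let $(X,d)$ be a (nonempty) compact metric space and $\alpha:X\to X$ a continuous map that is a finite-sheeted cover on its essential set $X_\alpha$, i.e. $\sup_{x\in X_\alpha}|\alpha^{-1}(x)\cap X_\alpha|<\infty$. Suppose that $\omega(\alpha)\le h(\alpha)$. Then (i) if $\omega(\alpha)=0$ then $h(\alpha)=\gamma(\alpha)$; (ii) if $\gamma(\alpha)=0$ then $h(\alpha)=\omega(\alpha)$.
   Context: $M_\alpha(X)$ is the set of Borel $\alpha$-invariant probability measures on $X$. A point $x\in X$ is essential if every neighborhood $V$ of $x$ satisfies $\mu(V)>0$ for some $\mu\in M_\alpha(X)$; $X_\alpha$ is the (closed) set of essential points, and $\alpha(X_\alpha)=X_\alpha$. For $x\in X_\alpha$ put $\tilde\alpha^{-n}(x):=\alpha^{-n}(x)\cap X_\alpha$. Put $d_n(x,y):=\max_{0\le i\le n-1}d(\alpha^i(x),\alpha^i(y))$. A set $E\subset X$ is $(n,\varepsilon)$-spanning if for every $x\in X$ there is $y\in E$ with $d_n(x,y)<\varepsilon$; a set $E\subset X_\alpha$ is $(n,\varepsilon)$-spanning for $X_\alpha$ if for every $x\in X_\alpha$ there is $y\in E$ with $d_n(x,y)<\varepsilon$. Topological entropy: $h(\alpha):=\ln\lim_{\varepsilon\to0}\limsup_{n\to\infty}\inf\{|E|^{1/n}: E \text{ is }(n,\varepsilon)\text{-spanning}\}$. Inverse rami-rate: $\omega(\alpha):=\ln\limsup_{n\to\infty}\sup_{x\in X_\alpha}|\tilde\alpha^{-n}(x)|^{1/n}$. Forward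 entropy: $\gamma(\alpha):=\ln\lim_{\varepsilon\to0}\limsup_{n\to\infty}\inf\{|\alpha^n(E)|^{1/n}: E\text{ is }(n,\varepsilon)\text{-spanning for }X_\alpha\}$. *)

theory Defs
  imports "HOL-Probability.Probability"
begin

text \<open>Cardinalities are extended reals, so that infinite sets count as \<open>\<infinity>\<close>
  (\<^const>\<open>card\<close> would give 0), and the growth rates may be infinite.\<close>

definition ecard :: "'a set \<Rightarrow> ereal"
  where "ecard A = (if finite A then ereal (real (card A)) else \<infinity>)"

definition ereal_root :: "nat \<Rightarrow> ereal \<Rightarrow> ereal"
  where "ereal_root n x =
    (case x of ereal r \<Rightarrow> ereal (root n r) | PInfty \<Rightarrow> \<infinity> | MInfty \<Rightarrow> -\<infinity>)"

definition ereal_ln :: "ereal \<Rightarrow> ereal"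
  where "ereal_ln x =
    (case x of ereal r \<Rightarrow> (if r > 0 then ereal (ln r) else -\<infinity>) | PInfty \<Rightarrow> \<infinity> | MInfty \<Rightarrow> -\<infinity>)"

text \<open>The compact metric space is the whole type \<^typ>\<open>'a\<close>; compactness of \<^term>\<open>UNIV :: 'a set\<close>
  is a hypothesis of the theorem.\<close>

definition invariant_measures :: "('a::metric_space \<Rightarrow> 'a) \<Rightarrow> 'a measure set"
  where "invariant_measures \<alpha> =
    {\<mu>. prob_space \<mu> \<and> sets \<mu> = sets borel \<and>
       (\<forall>A\<in>sets borel. measure \<mu> (\<alpha> -` A) = measure \<mu> A)}"

text \<open>Only open neighbourhoods are tested: an arbitrary neighbourhood need not be measurable, and
  each one contains an open one.\<close>

definition essential_set :: "('a::metric_space \<Rightarrow> 'a) \<Rightarrow> 'a set"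
  where "essential_set \<alpha> =
    {x. \<forall>V. open V \<and> x \<in> V \<longrightarrow> (\<exists>\<mu>\<in>invariant_measures \<alpha>. measure \<mu> V > 0)}"

definition essential_preimage :: "('a::metric_space \<Rightarrow> 'a) \<Rightarrow> nat \<Rightarrow> 'a \<Rightarrow> 'a set"
  where "essential_preimage \<alpha> n x = (\<alpha> ^^ n) -` {x} \<inter> essential_set \<alpha>"

text \<open>With truncated subtraction, the value at \<open>n = 0\<close> is \<^term>\<open>dist x y\<close>; only the behaviour
  as \<open>n\<close> tends to infinity matters below.\<close>

definition bowen_dist :: "('a::metric_space \<Rightarrow> 'a) \<Rightarrow> nat \<Rightarrow> 'a \<Rightarrow> 'a \<Rightarrow> real"
  where "bowen_dist \<alpha> n x y = (MAX i\<in>{0..n - 1}. dist ((\<alpha> ^^ i) x) ((\<alpha> ^^ i) y))"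

definition spanning :: "('a::metric_space \<Rightarrow> 'a) \<Rightarrow> 'a set \<Rightarrow> nat \<Rightarrow> real \<Rightarrow> 'a set \<Rightarrow> bool"
  where "spanning \<alpha> Y n \<epsilon> E \<longleftrightarrow> E \<subseteq> Y \<and> (\<forall>x\<in>Y. \<exists>y\<in>E. bowen_dist \<alpha> n x y < \<epsilon>)"

definition topological_entropy :: "('a::metric_space \<Rightarrow> 'a) \<Rightarrow> ereal"
  where "topological_entropy \<alpha> =
    ereal_ln (Lim (at_right 0) (\<lambda>\<epsilon>::real.
      limsup (\<lambda>n. INF E\<in>{E. spanning \<alpha> UNIV n \<epsilon> E}. ereal_root n (ecard E))))"

definition inverse_rami_rate :: "('a::metric_space \<Rightarrow> 'a) \<Rightarrow> ereal"
  where "inverse_rami_rate \<alpha> =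
    ereal_ln (limsup (\<lambda>n. SUP x\<in>essential_set \<alpha>. ereal_root n (ecard (essential_preimage \<alpha> n x))))"

definition forward_entropy :: "('a::metric_space \<Rightarrow> 'a) \<Rightarrow> ereal"
  where "forward_entropy \<alpha> =
    ereal_ln (Lim (at_right 0) (\<lambda>\<epsilon>::real.
      limsup (\<lambda>n. INF E\<in>{E. spanning \<alpha> (essential_set \<alpha>) n \<epsilon> E}.
        ereal_root n (ecard ((\<alpha> ^^ n) ` E)))))"

end

theory Submission
  imports Defs
begin

text \<open>Write \<open>H\<close>, \<open>G\<close>, \<open>W\<close> for the growth rates whose logarithms are \<open>h\<close>, \<open>\<gamma>\<close>, \<open>\<omega>\<close>. One has
  \<open>G \<le> H \<le> G W\<close>; if \<open>W = 1\<close> this gives \<open>H = G\<close>, and if \<open>G = 1\<close> it gives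
  \<open>H \<le> W\<close>, the converse being the hypothesis \<open>\<omega> \<le> h\<close>.

  The lower bound is immediate. For the upper bound, replacing a set \<open>E\<close> that spans the essential set
  by all essential points in \<open>\<alpha>\<^sup>-\<^sup>n (\<alpha>\<^sup>n (E))\<close> bounds the entropy of \<open>\<alpha>\<close> on its
  essential set by \<open>G W\<close>; it remains to see that the entropy of \<open>\<alpha>\<close> is carried by the essential
  set. By a Krylov--Bogoliubov argument, all orbits spend all but an arbitrarily small proportion of
  their time near the essential set, uniformly in the starting point. An orbit segment thus decomposes
  into blocks shadowed by essential points and few exceptional times, and the exceptional times have
  arbitrarily small influence on the exponential growth of the number of segments.\<close>

section \<open>Invariant measures from finitely additive contents\<close>

text \<open>By Tychonoff's theorem the functions into \<open>{0..1}\<close> are compact for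
  pointwise convergence, so the sequence has a cluster point. It satisfies every closed condition
  that holds eventually: otherwise one of its neighbourhoods would miss all late terms.\<close>

lemma cluster_point_of_bounded_contents:
  fixes m :: "nat \<Rightarrow> 'a set \<Rightarrow> real"
  assumes "\<And>k A. m k A \<in> {0..1}"
  obtains M where "\<And>P. closed {f. P f} \<Longrightarrow> eventually (\<lambda>k. P (m k)) sequentially \<Longrightarrow> P M"
proof -
  define S where "S = (PiE UNIV (\<lambda>_. {0..1}) :: ('a set \<Rightarrow> real) set)"
  have "compactin (product_topology (\<lambda>_. euclidean) UNIV) S"
    unfolding S_def by (subst compactin_PiE) auto
  then have cS: "compact S"
    by (simp add: euclidean_product_topology)
  define F where "F = filtermap m sequentially"
  have F: "F \<noteq> bot" "eventually (\<lambda>x. x \<in> S) F"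
    using assms by (auto simp: F_def S_def filtermap_bot_iff eventually_filtermap PiE_iff)
  then obtain M where M: "inf (nhds M) F \<noteq> bot"
    using cS unfolding compact_filter by blast
  show ?thesis
  proof (rule that)
    fix P assume P: "closed {f. P f}" "eventually (\<lambda>k. P (m k)) sequentially"
    show "P M"
    proof (rule ccontr)
      assume "\<not> P M"
      then have "eventually (\<lambda>f. \<not> P f) (nhds M)"
        using P(1) by (intro eventually_nhds[THEN iffD2] exI[of _ "- {f. P f}"]) auto
      moreover have "eventually P F"
        using P(2) by (simp add: F_def eventually_filtermap)
      ultimately have "eventually (\<lambda>_. False) (inf (nhds M) F)"
        unfolding eventually_inf by blast
      with M show False by (simp add: trivial_limit_def)
    qed
  qed
qed

section \<open>Caratheodory construction of a Borel measure from a finitely additive content\<close>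

locale compact_content =
  fixes m :: "'a::metric_space set \<Rightarrow> real"
  assumes compact_UNIV: "compact (UNIV :: 'a set)"
    and nonneg: "0 \<le> m A"
    and total: "m UNIV = 1"
    and additive: "A \<inter> B = {} \<Longrightarrow> m (A \<union> B) = m A + m B"
begin

lemma mono: "A \<subseteq> B \<Longrightarrow> m A \<le> m B"
  using additive[of A "B - A"] nonneg[of "B - A"] by (simp add: Un_absorb1)

lemma subadditive: "m (A \<union> B) \<le> m A + m B"
  using additive[of A "B - A"] mono[of "B - A" B] by auto

lemma empty: "m {} = 0"
  using additive[of "{}" "{}"] by simp

text \<open>The content \<open>m\<close> need not be regular. As in the Riesz representation
  theorem, open sets are therefore measured from inside by closed ones, and arbitrary sets from
  outside by open ones.\<close>

definition inner_content :: "'a set \<Rightarrow> ennreal"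
  where "inner_content U = (SUP K\<in>{K. closed K \<and> K \<subseteq> U}. ennreal (m K))"

definition outer_content :: "'a set \<Rightarrow> ennreal"
  where "outer_content A = (INF U\<in>{U. open U \<and> A \<subseteq> U}. inner_content U)"

lemma inner_mono: "U \<subseteq> V \<Longrightarrow> inner_content U \<le> inner_content V"
  unfolding inner_content_def by (rule SUP_subset_mono) auto

lemma le_inner: "closed K \<Longrightarrow> K \<subseteq> U \<Longrightarrow> ennreal (m K) \<le> inner_content U"
  unfolding inner_content_def by (rule SUP_upper) auto

lemma inner_le_1: "inner_content U \<le> 1"
  unfolding inner_content_def using mono[of _ UNIV] total
  by (auto intro!: SUP_least simp: ennreal_le_1)

lemma inner_empty: "inner_content {} = 0"
  unfolding inner_content_def by (auto simp: empty)

text \<open>Normality gives disjoint open sets \<open>P\<close> and \<open>Q\<close> around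
  \<open>K - V\<close> and \<open>K - U\<close>. Then \<open>K - Q\<close> is a closed subset of
  \<open>U\<close>, \<open>K - P\<close> is a closed subset of \<open>V\<close>, and together they
  cover \<open>K\<close>.\<close>

lemma inner_Un:
  assumes "open U" "open V"
  shows "inner_content (U \<union> V) \<le> inner_content U + inner_content V"
  unfolding inner_content_def[of "U \<union> V"]
proof (rule SUP_least, clarify)
  fix K assume K: "closed K" "K \<subseteq> U \<union> V"
  have "closed (K - V)" "closed (K - U)" "(K - V) \<inter> (K - U) = {}"
    using K assms by auto
  then obtain P Q where PQ: "open P" "open Q" "K - V \<subseteq> P" "K - U \<subseteq> Q" "P \<inter> Q = {}"
    using t4_space by meson
  have "m K \<le> m ((K - Q) \<union> (K - P))"
    using PQ by (intro mono) auto
  also have "\<dots> \<le> m (K - Q) + m (K - P)" by (rule subadditive)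
  finally have "ennreal (m K) \<le> ennreal (m (K - Q)) + ennreal (m (K - P))"
    using nonneg by (simp flip: ennreal_plus)
  also have "\<dots> \<le> inner_content U + inner_content V"
    using PQ K by (intro add_mono le_inner) auto
  finally show "ennreal (m K) \<le> inner_content U + inner_content V" .
qed

lemma inner_UN_lessThan:
  assumes "\<And>i::nat. open (U i)"
  shows "inner_content (\<Union>i<N. U i) \<le> (\<Sum>i<N. inner_content (U i))"
proof (induction N)
  case (Suc N)
  have "inner_content (\<Union>i<Suc N. U i) \<le> inner_content (\<Union>i<N. U i) + inner_content (U N)"
    using inner_Un[of "\<Union>i<N. U i" "U N"] assms by (auto simp: lessThan_Suc Un_commute)
  with Suc show ?case by (auto intro: order_trans add_right_mono)
qed (simp add: inner_empty)

text \<open>Compactness supplies the countable subadditivity that finite additivity of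
  \<open>m\<close> alone does not: finitely many \<open>U i\<close> already cover a closed
  \<open>K\<close>.\<close>

lemma inner_UN:
  assumes "\<And>i::nat. open (U i)"
  shows "inner_content (\<Union>i. U i) \<le> (\<Sum>i. inner_content (U i))"
  unfolding inner_content_def[of "\<Union>i. U i"]
proof (rule SUP_least, clarify)
  fix K assume K: "closed K" "K \<subseteq> (\<Union>i. U i)"
  then have "compact K"
    using compact_UNIV compact_Int_closed[of UNIV K] by simp
  then obtain C where C: "finite C" "K \<subseteq> (\<Union>i\<in>C. U i)"
    by (rule compactE_image[of K UNIV U]) (use K(2) assms in auto)
  obtain N where N: "C \<subseteq> {..<N}"
    using C(1) finite_nat_iff_bounded by blast
  have "K \<subseteq> (\<Union>i<N. U i)" using C(2) N by blast
  then have "ennreal (m K) \<le> inner_content (\<Union>i<N. U i)"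
    using K(1) by (rule le_inner[rotated])
  also have "\<dots> \<le> (\<Sum>i<N. inner_content (U i))" using assms by (rule inner_UN_lessThan)
  also have "\<dots> \<le> (\<Sum>i. inner_content (U i))" by (rule sum_le_suminf) auto
  finally show "ennreal (m K) \<le> (\<Sum>i. inner_content (U i))" .
qed

lemma outer_open: "open U \<Longrightarrow> outer_content U = inner_content U"
  unfolding outer_content_def by (intro antisym INF_lower INF_greatest inner_mono) auto

lemma outer_le: "open U \<Longrightarrow> A \<subseteq> U \<Longrightarrow> outer_content A \<le> inner_content U"
  unfolding outer_content_def by (rule INF_lower) auto

lemma le_outer: "closed K \<Longrightarrow> ennreal (m K) \<le> outer_content K"
  unfolding outer_content_def by (rule INF_greatest) (auto intro: le_inner)

lemma outer_mono: "A \<subseteq> B \<Longrightarrow> outer_content A \<le> outer_content B"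
  unfolding outer_content_def by (rule INF_superset_mono) auto

lemma outer_UN: "outer_content (\<Union>i::nat. A i) \<le> (\<Sum>i. outer_content (A i))"
proof (rule ennreal_le_epsilon)
  fix e :: real assume "0 < e" "(\<Sum>i. outer_content (A i)) < top"
  define d where "d i = e * (1/2) ^ Suc i" for i
  have "\<exists>U. open U \<and> A i \<subseteq> U \<and> inner_content U \<le> outer_content (A i) + ennreal (d i)" for i
  proof -
    have "outer_content (A i) \<le> 1"
      using outer_le[of UNIV "A i"] inner_le_1[of UNIV] by auto
    then have "outer_content (A i) \<noteq> \<infinity>"
      by (auto simp: top_unique)
    moreover have "0 < d i" using \<open>0 < e\<close> by (simp add: d_def)
    ultimately obtain U where "U \<in> {U. open U \<and> A i \<subseteq> U}" "inner_content U < outer_content (A i) + d i"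
      using INF_approx_ennreal[OF _ outer_content_def] by metis
    then show ?thesis by (auto intro!: exI[of _ U])
  qed
  then obtain U where U: "\<And>i. open (U i)" "\<And>i. A i \<subseteq> U i"
      "\<And>i. inner_content (U i) \<le> outer_content (A i) + ennreal (d i)"
    by metis
  have "outer_content (\<Union>i. A i) \<le> inner_content (\<Union>i. U i)"
    using U by (intro outer_le) auto
  also have "\<dots> \<le> (\<Sum>i. inner_content (U i))" using U(1) by (rule inner_UN)
  also have "\<dots> \<le> (\<Sum>i. outer_content (A i) + ennreal (d i))"
    using U(3) by (intro suminf_le) auto
  also have "\<dots> = (\<Sum>i. outer_content (A i)) + (\<Sum>i. ennreal (d i))"
    by (rule suminf_add[symmetric]) auto
  also have "(\<Sum>i. ennreal (d i)) = ennreal e"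
  proof -
    have "d sums e" unfolding d_def using sums_mult[OF power_half_series, of e] by simp
    then show ?thesis using \<open>0 < e\<close> by (intro suminf_ennreal_eq) (auto simp: d_def[abs_def])
  qed
  finally show "outer_content (\<Union>i. A i) \<le> (\<Sum>i. outer_content (A i)) + ennreal e" .
qed

lemma outer_empty: "outer_content {} = 0"
  by (simp add: outer_open inner_empty)

lemma outer_measure_space_outer_content: "outer_measure_space UNIV outer_content"
  unfolding outer_measure_space_def positive_def increasing_def countably_subadditive_def
  using outer_mono outer_UN by (auto simp: outer_empty)

lemma outer_split: "outer_content A \<le> outer_content (W \<inter> A) + outer_content ((UNIV - W) \<inter> A)"
proof -
  interpret P: sigma_algebra UNIV "UNIV :: 'a set set"
    using sigma_algebra_Pow[of UNIV] by simp
  have "subadditive UNIV outer_content"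
    using outer_measure_space_outer_content
    by (intro P.countably_subadditive_subadditive) (auto simp: outer_measure_space_def)
  then have "outer_content ((W \<inter> A) \<union> ((UNIV - W) \<inter> A)) \<le> outer_content (W \<inter> A) + outer_content ((UNIV - W) \<inter> A)"
    by (intro subadditiveD) auto
  moreover have "(W \<inter> A) \<union> ((UNIV - W) \<inter> A) = A" by auto
  ultimately show ?thesis by simp
qed

text \<open>The content is additive on disjoint closed sets. The nontrivial inequality follows by
  exhausting \<open>W \<inter> U\<close> by closed \<open>K\<close>, and then the open set
  \<open>U - K\<close>, which still covers \<open>A - W\<close>, by closed \<open>L\<close>.\<close>

lemma open_in_lambda_system:
  assumes "open W"
  shows "W \<in> lambda_system UNIV UNIV outer_content"
  unfolding lambda_system_def
proof (clarify, intro conjI ballI antisym)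
  fix A
  show "outer_content A \<le> outer_content (W \<inter> A) + outer_content ((UNIV - W) \<inter> A)"
    by (rule outer_split)
  show "outer_content (W \<inter> A) + outer_content ((UNIV - W) \<inter> A) \<le> outer_content A"
    unfolding outer_content_def[of A]
  proof (rule INF_greatest, clarify)
    fix U assume U: "open U" "A \<subseteq> U"
    have L: "inner_content (U - K) + ennreal (m K) \<le> inner_content U" if K: "closed K" "K \<subseteq> W \<inter> U" for K
    proof -
      have "(SUP L\<in>{L. closed L \<and> L \<subseteq> U - K}. ennreal (m L) + ennreal (m K)) \<le> inner_content U"
      proof (rule SUP_least, clarify)
        fix L assume L: "closed L" "L \<subseteq> U - K"
        have "ennreal (m L) + ennreal (m K) = ennreal (m (L \<union> K))"
          using L nonneg by (subst additive) auto
        also have "\<dots> \<le> inner_content U" using L K by (intro le_inner) auto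
        finally show "ennreal (m L) + ennreal (m K) \<le> inner_content U" .
      qed
      then show ?thesis
        unfolding inner_content_def[of "U - K"] by (subst ennreal_SUP_add_left[symmetric]) auto
    qed
    have "(SUP K\<in>{K. closed K \<and> K \<subseteq> W \<inter> U}. outer_content ((UNIV - W) \<inter> A) + ennreal (m K)) \<le> inner_content U"
    proof (rule SUP_least, clarify)
      fix K assume K: "closed K" "K \<subseteq> W \<inter> U"
      have "outer_content ((UNIV - W) \<inter> A) \<le> inner_content (U - K)"
        using U K assms by (intro outer_le) auto
      with L[OF K] show "outer_content ((UNIV - W) \<inter> A) + ennreal (m K) \<le> inner_content U"
        by (meson add_right_mono order_trans)
    qed
    then have "outer_content ((UNIV - W) \<inter> A) + inner_content (W \<inter> U) \<le> inner_content U"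
      unfolding inner_content_def[of "W \<inter> U"]
      by (subst ennreal_SUP_add_right) auto
    moreover have "outer_content (W \<inter> A) \<le> inner_content (W \<inter> U)"
      using U assms by (intro outer_le) auto
    ultimately show "outer_content (W \<inter> A) + outer_content ((UNIV - W) \<inter> A) \<le> inner_content U"
      by (metis add.commute add_left_mono order_trans)
  qed
qed auto

text \<open>Caratheodory's theorem gives a measure on the lambda system, which contains the open and
  hence the Borel sets. As with weak limits, closed sets can only gain mass in the passage from
  \<open>m\<close>.\<close>

lemma induced_measure:
  obtains \<mu> where "prob_space \<mu>" "sets \<mu> = sets borel"
    "\<And>U. open U \<Longrightarrow> emeasure \<mu> U = (SUP K\<in>{K. closed K \<and> K \<subseteq> U}. ennreal (m K))"
    "\<And>K. closed K \<Longrightarrow> m K \<le> measure \<mu> K"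
proof -
  interpret P: sigma_algebra UNIV "UNIV :: 'a set set"
    using sigma_algebra_Pow[of UNIV] by simp
  have L: "measure_space UNIV (lambda_system UNIV UNIV outer_content) outer_content"
    using outer_measure_space_outer_content by (rule P.caratheodory_lemma)
  then interpret L: sigma_algebra UNIV "lambda_system UNIV UNIV outer_content"
    by (simp add: measure_space_def)
  have sub: "sets borel \<subseteq> lambda_system UNIV UNIV outer_content"
    unfolding borel_def using open_in_lambda_system
    by (auto simp: intro!: L.sigma_sets_subset)
  define \<mu> where "\<mu> = measure_of UNIV (sets (borel :: 'a measure)) outer_content"
  have ms: "measure_space UNIV (sets borel) outer_content"
    using measure_down[OF L _ sub] sets.sigma_algebra_axioms[of borel] by (simp add: space_borel)
  have sets: "sets \<mu> = sets borel" and space: "space \<mu> = UNIV"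
    using sets.sigma_sets_eq[of "borel :: 'a measure"] by (auto simp: \<mu>_def sets_measure_of_conv space_measure_of_conv)
  have em: "emeasure \<mu> A = outer_content A" if "A \<in> sets borel" for A
    using that ms emeasure_measure_of_sigma[of UNIV "sets borel" outer_content A]
    by (simp add: \<mu>_def measure_space_def)
  \<comment> \<open>The whole space is itself closed, so no mass is lost.\<close>
  have one: "inner_content UNIV = 1"
    using inner_le_1[of UNIV] le_inner[of UNIV UNIV] total by (auto intro: antisym)
  interpret prob_space \<mu>
    by (rule prob_spaceI) (simp add: em space outer_open one)
  show ?thesis
  proof (rule that[of \<mu>])
    show "prob_space \<mu>" by (rule prob_space_axioms)
    show "sets \<mu> = sets borel" by (rule sets)
    show "emeasure \<mu> U = (SUP K\<in>{K. closed K \<and> K \<subseteq> U}. ennreal (m K))" if "open U" for U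
      using that by (simp add: em outer_open inner_content_def)
    show "m K \<le> measure \<mu> K" if "closed K" for K
      using le_outer[OF that] em[of K] that by (metis borel_closed emeasure_eq_measure ennreal_le_iff measure_nonneg)
  qed
qed

end

text \<open>Closed subsets of the preimage of an open \<open>U\<close> are pushed forward, where
  compactness keeps the image closed, and closed subsets of \<open>U\<close> are pulled back;
  invariance of \<open>m\<close> compares the contents. Agreement on open sets extends to Borel sets
  because they form an intersection-stable generator.\<close>

lemma invariant_measure_of_content:
  fixes \<alpha> :: "'a::metric_space \<Rightarrow> 'a"
  assumes "compact_content m" and cont: "continuous_on UNIV \<alpha>"
    and inv: "\<And>A. m (\<alpha> -` A) = m A"
  obtains \<mu> where "\<mu> \<in> invariant_measures \<alpha>" "\<And>K. closed K \<Longrightarrow> m K \<le> measure \<mu> K"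
proof -
  interpret compact_content m by fact
  obtain \<mu> where \<mu>: "prob_space \<mu>" "sets \<mu> = sets borel"
    and em: "\<And>U. open U \<Longrightarrow> emeasure \<mu> U = (SUP K\<in>{K. closed K \<and> K \<subseteq> U}. ennreal (m K))"
    and le: "\<And>K. closed K \<Longrightarrow> m K \<le> measure \<mu> K"
    using induced_measure by blast
  interpret prob_space \<mu> by fact
  have space: "space \<mu> = UNIV"
    using sets_eq_imp_space_eq[OF \<mu>(2)] by simp
  have meas: "\<alpha> \<in> measurable \<mu> \<mu>"
    using borel_measurable_continuous_onI[OF cont] \<mu>(2) by (simp cong: measurable_cong_sets)
  have eq_open: "emeasure \<mu> (\<alpha> -` U) = emeasure \<mu> U" if U: "open U" for U
  proof (rule antisym)
    have oU: "open (\<alpha> -` U)" using cont U by (simp add: continuous_on_open_vimage)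
    show "emeasure \<mu> (\<alpha> -` U) \<le> emeasure \<mu> U"
      unfolding em[OF oU] em[OF U]
    proof (rule SUP_least, clarify)
      fix L assume L: "closed L" "L \<subseteq> \<alpha> -` U"
      have "compact L" using compact_UNIV compact_Int_closed[of UNIV L] L(1) by simp
      then have "closed (\<alpha> ` L)"
        using cont by (intro compact_imp_closed compact_continuous_image) (auto intro: continuous_on_subset)
      moreover have "m L \<le> m (\<alpha> ` L)"
        using mono[of L "\<alpha> -` \<alpha> ` L"] inv[of "\<alpha> ` L"] by auto
      ultimately show "ennreal (m L) \<le> (SUP K\<in>{K. closed K \<and> K \<subseteq> U}. ennreal (m K))"
        using L(2) by (intro SUP_upper2[of "\<alpha> ` L"]) (auto intro: ennreal_leI)
    qed
    show "emeasure \<mu> U \<le> emeasure \<mu> (\<alpha> -` U)"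
      unfolding em[OF oU] em[OF U]
    proof (rule SUP_least, clarify)
      fix K assume K: "closed K" "K \<subseteq> U"
      have "closed (\<alpha> -` K)" using cont K by (simp add: continuous_on_closed_vimage)
      then show "ennreal (m K) \<le> (SUP K\<in>{K. closed K \<and> K \<subseteq> \<alpha> -` U}. ennreal (m K))"
        using K(2) inv[of K] by (intro SUP_upper2[of "\<alpha> -` K"]) auto
    qed
  qed
  have "distr \<mu> \<mu> \<alpha> = \<mu>"
  proof (rule measure_eqI_generator_eq[where E = "{S. open S}" and \<Omega> = UNIV and A = "\<lambda>_. UNIV"])
    show "emeasure (distr \<mu> \<mu> \<alpha>) X = emeasure \<mu> X" if "X \<in> {S. open S}" for X
      using that meas \<mu>(2) by (simp add: emeasure_distr space eq_open)
    show "sets (distr \<mu> \<mu> \<alpha>) = sigma_sets UNIV {S. open S}" "sets \<mu> = sigma_sets UNIV {S. open S}"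
      using \<mu>(2) by (auto simp: borel_def)
    show "emeasure (distr \<mu> \<mu> \<alpha>) UNIV \<noteq> \<infinity>" for i :: nat
      using meas prob_space.emeasure_space_1[OF prob_space_distr[OF meas]] by (simp add: space)
  qed (auto simp: Int_stable_def)
  then have "measure \<mu> (\<alpha> -` A) = measure \<mu> A" if "A \<in> sets borel" for A
    using measure_distr[OF meas, of A] that \<mu>(2) by (simp add: space)
  with \<mu> have "\<mu> \<in> invariant_measures \<alpha>" by (simp add: invariant_measures_def)
  then show ?thesis using le by (rule that)
qed

section \<open>Visits outside a neighbourhood of the essential set\<close>

text \<open>A nonessential point has a neighbourhood that is null for every invariant measure, and
  finitely many of these cover \<open>K\<close>.\<close>

lemma measure_compact_nonessential:
  fixes \<alpha> :: "'a::metric_space \<Rightarrow> 'a"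
  assumes "compact K" "K \<inter> essential_set \<alpha> = {}" "\<mu> \<in> invariant_measures \<alpha>"
  shows "measure \<mu> K = 0"
proof -
  have \<mu>: "prob_space \<mu>" "sets \<mu> = sets borel"
    using assms(3) by (auto simp: invariant_measures_def)
  interpret prob_space \<mu> by fact
  have "\<exists>V. open V \<and> x \<in> V \<and> measure \<mu> V = 0" if "x \<in> K" for x
  proof -
    have "x \<notin> essential_set \<alpha>" using assms(2) that by auto
    then obtain V where "open V" "x \<in> V" "\<not> measure \<mu> V > 0"
      using assms(3) by (auto simp: essential_set_def)
    then show ?thesis by (metis zero_less_measure_iff)
  qed
  then obtain V where V: "\<And>x. x \<in> K \<Longrightarrow> open (V x)" "\<And>x. x \<in> K \<Longrightarrow> x \<in> V x"
      "\<And>x. x \<in> K \<Longrightarrow> measure \<mu> (V x) = 0"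
    by metis
  obtain C where C: "C \<subseteq> K" "finite C" "K \<subseteq> (\<Union>x\<in>C. V x)"
    by (rule compactE_image[OF assms(1), of K V]) (use V in auto)
  have VC: "V ` C \<subseteq> sets \<mu>" using V(1) C(1) \<mu>(2) by auto
  have "measure \<mu> K \<le> measure \<mu> (\<Union>x\<in>C. V x)"
    using C VC by (intro finite_measure_mono) auto
  also have "\<dots> \<le> (\<Sum>x\<in>C. measure \<mu> (V x))"
    using C(2) VC by (rule finite_measure_subadditive_finite)
  also have "\<dots> = 0" using V(3) C(1) by (intro sum.neutral) auto
  finally show ?thesis using measure_nonneg[of \<mu> K] by linarith
qed

lemma card_eq_sum_indicator:
  fixes n :: nat
  shows "real (card {i. i < n \<and> f i \<in> A}) = (\<Sum>i<n. indicator A (f i))"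
proof -
  have "real (card {i. i < n \<and> f i \<in> A}) = (\<Sum>i\<in>{i \<in> {..<n}. f i \<in> A}. 1)"
    by (simp add: lessThan_def)
  also have "\<dots> = (\<Sum>i<n. if f i \<in> A then 1 else 0)"
    by (rule sum.inter_filter) auto
  finally show ?thesis unfolding indicator_def of_bool_def .
qed

text \<open>Krylov--Bogoliubov: if long orbit segments spent a positive fraction of time in the compact set
  \<^term>\<open>- U\<close>, a limit of their empirical distributions would be an invariant measure charging it.\<close>

lemma uniform_visit_frequency:
  fixes \<alpha> :: "'a::metric_space \<Rightarrow> 'a"
  assumes comp: "compact (UNIV :: 'a set)" and cont: "continuous_on UNIV \<alpha>"
    and U: "open U" "essential_set \<alpha> \<subseteq> U" and \<delta>: "0 < \<delta>"
  shows "eventually (\<lambda>n. \<forall>x. real (card {i. i < n \<and> (\<alpha> ^^ i) x \<notin> U}) \<le> \<delta> * real n) sequentially"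
proof (rule ccontr)
  assume "\<not> ?thesis"
  then have "\<exists>n\<ge>N. \<exists>x. real (card {i. i < n \<and> (\<alpha> ^^ i) x \<notin> U}) > \<delta> * real n" for N
    unfolding eventually_sequentially by (meson not_le)
  \<comment> \<open>The bound \<open>n k \<ge> k\<close> makes the lengths of the offending segments
    tend to infinity.\<close>
  then obtain n x where n: "\<And>k. n k \<ge> k"
    and x: "\<And>k. real (card {i. i < n k \<and> (\<alpha> ^^ i) (x k) \<notin> U}) > \<delta> * real (n k)"
    by metis
  have n0: "n k > 0" for k
    using x[of k] by (cases "n k = 0") auto
  \<comment> \<open>This is the empirical distribution of the orbit segment of length
    \<open>n k\<close> from \<open>x k\<close>.\<close>
  define m :: "nat \<Rightarrow> 'a set \<Rightarrow> real"
    where "m k A = (\<Sum>i<n k. indicator A ((\<alpha> ^^ i) (x k))) / real (n k)" for k A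
  have bounded: "m k A \<in> {0..1}" for k A
  proof -
    have "(\<Sum>i<n k. indicator A ((\<alpha> ^^ i) (x k))) \<le> (\<Sum>i<n k. 1 :: real)"
      by (intro sum_mono) (auto simp: indicator_def)
    then show ?thesis using n0[of k] by (auto simp: m_def sum_nonneg divide_le_eq)
  qed
  obtain M where M: "\<And>P. closed {f. P f} \<Longrightarrow> eventually (\<lambda>k. P (m k)) sequentially \<Longrightarrow> P M"
    using cluster_point_of_bounded_contents[of m, OF bounded] by blast
  \<comment> \<open>Evaluation at a fixed set is continuous for pointwise convergence, so equations
    and weak inequalities between such values are closed conditions and pass from \<open>m k\<close>
    to \<open>M\<close>.\<close>
  note [continuous_intros] = continuous_on_product_coordinates
  have "compact_content M"
  proof
    show "compact (UNIV :: 'a set)" by fact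
    show "0 \<le> M A" for A
      by (rule M) (auto intro!: closed_Collect_le continuous_intros simp: m_def sum_nonneg)
    show "M UNIV = 1"
      by (rule M) (use n0 in \<open>auto intro!: closed_Collect_eq continuous_intros simp: m_def\<close>)
    show "M (A \<union> B) = M A + M B" if "A \<inter> B = {}" for A B
      by (rule M) (use that in \<open>auto intro!: closed_Collect_eq continuous_intros
          simp: m_def sum.distrib add_divide_distrib indicator_add[symmetric]\<close>)
  qed
  moreover have "M (\<alpha> -` A) = M A" for A
  proof -
    have diff: "\<bar>m k (\<alpha> -` A) - m k A\<bar> \<le> 1 / real (n k)" for k
    proof -
      \<comment> \<open>Visits to the preimage of \<open>A\<close> are visits to \<open>A\<close>
        shifted by one time unit, so the difference telescopes to two boundary terms.\<close>
      define g where "g i = (indicator A ((\<alpha> ^^ i) (x k)) :: real)" for i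
      have "m k (\<alpha> -` A) - m k A = (\<Sum>i<n k. g (Suc i) - g i) / real (n k)"
        by (simp add: m_def g_def sum_subtractf diff_divide_distrib indicator_def)
      also have "\<dots> = (g (n k) - g 0) / real (n k)"
        by (simp add: sum_lessThan_telescope)
      finally show ?thesis
        using n0[of k] by (auto simp: g_def indicator_def abs_if)
    qed
    \<comment> \<open>The bound in \<open>diff\<close> depends on \<open>k\<close>; a fixed
      \<open>e\<close> turns it into a closed condition that holds eventually.\<close>
    have "\<bar>M (\<alpha> -` A) - M A\<bar> \<le> e" if "e > 0" for e
    proof (rule M)
      show "closed {f. \<bar>f (\<alpha> -` A) - f A\<bar> \<le> e}"
        by (intro closed_Collect_le continuous_intros)
      have "eventually (\<lambda>k. 1 / real k \<le> e) sequentially"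
        using order_tendstoD(2)[OF lim_1_over_n that] by (auto elim: eventually_mono)
      with eventually_ge_at_top[of 1]
      show "\<forall>\<^sub>F k in sequentially. \<bar>m k (\<alpha> -` A) - m k A\<bar> \<le> e"
      proof eventually_elim
        case (elim k)
        have "\<bar>m k (\<alpha> -` A) - m k A\<bar> \<le> 1 / real (n k)" by (rule diff)
        also have "\<dots> \<le> 1 / real k" using n[of k] elim by (intro divide_left_mono) auto
        also have "\<dots> \<le> e" using elim by simp
        finally show ?case .
      qed
    qed
    then show ?thesis
      by (metis abs_le_zero_iff dense_ge eq_iff_diff_eq_0)
  qed
  ultimately obtain \<mu> where \<mu>: "\<mu> \<in> invariant_measures \<alpha>" "\<And>K. closed K \<Longrightarrow> M K \<le> measure \<mu> K"
    using invariant_measure_of_content[OF _ cont] by metis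
  \<comment> \<open>Since \<open>- U\<close> is closed, this lower bound carries over to
    \<open>\<mu>\<close>.\<close>
  have "\<delta> \<le> M (- U)"
  proof (rule M)
    show "closed {f. \<delta> \<le> f (- U)}"
      by (intro closed_Collect_le continuous_intros)
    have "\<delta> \<le> m k (- U)" for k
    proof -
      have "real (card {i. i < n k \<and> (\<alpha> ^^ i) (x k) \<notin> U}) = (\<Sum>i<n k. indicator (- U) ((\<alpha> ^^ i) (x k)))"
        using card_eq_sum_indicator[of "n k" "\<lambda>i. (\<alpha> ^^ i) (x k)" "- U"] by simp
      then show ?thesis using x[of k] n0[of k] by (simp add: m_def field_simps)
    qed
    then show "\<forall>\<^sub>F k in sequentially. \<delta> \<le> m k (- U)" by simp
  qed
  moreover have "measure \<mu> (- U) = 0"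
    using U comp \<mu>(1) compact_Int_closed[of UNIV "- U"]
    by (intro measure_compact_nonessential) auto
  ultimately show False using \<mu>(2)[OF closed_Compl[OF U(1)]] \<delta> by simp
qed

section \<open>Covering by orbit pieces\<close>

text \<open>With \<open>i < n\<close> the condition is vacuous at \<open>n = 0\<close>, unlike a
  bound on \<open>bowen_dist\<close>, so segments of length 0 can start an induction.\<close>

definition bowen_fine :: "('a::metric_space \<Rightarrow> 'a) \<Rightarrow> nat \<Rightarrow> real \<Rightarrow> 'a set \<Rightarrow> bool"
  where "bowen_fine \<alpha> n \<epsilon> P \<longleftrightarrow> (\<forall>x\<in>P. \<forall>y\<in>P. \<forall>i<n. dist ((\<alpha> ^^ i) x) ((\<alpha> ^^ i) y) < \<epsilon>)"

text \<open>Pieces without centres can be concatenated without choosing points, and a real bound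
  \<open>k\<close> admits values such as \<open>D * c ^ n * r ^ b\<close>.\<close>

definition bowen_cover :: "('a::metric_space \<Rightarrow> 'a) \<Rightarrow> nat \<Rightarrow> real \<Rightarrow> 'a set \<Rightarrow> real \<Rightarrow> bool"
  where "bowen_cover \<alpha> n \<epsilon> A k \<longleftrightarrow>
    (\<exists>\<P>. finite \<P> \<and> A \<subseteq> \<Union>\<P> \<and> real (card \<P>) \<le> k \<and> (\<forall>P\<in>\<P>. bowen_fine \<alpha> n \<epsilon> P))"

lemma bowen_cover_mono:
  assumes "bowen_cover \<alpha> n \<epsilon> A k" "n' \<le> n" "A' \<subseteq> A" "k \<le> k'"
  shows "bowen_cover \<alpha> n' \<epsilon> A' k'"
proof -
  have fine: "bowen_fine \<alpha> n' \<epsilon> P" if "bowen_fine \<alpha> n \<epsilon> P" for P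
    using that assms(2) unfolding bowen_fine_def by (meson less_le_trans)
  obtain \<P> where "finite \<P>" "A \<subseteq> \<Union>\<P>" "real (card \<P>) \<le> k" "\<forall>P\<in>\<P>. bowen_fine \<alpha> n \<epsilon> P"
    using assms(1) unfolding bowen_cover_def by (elim exE conjE)
  then show ?thesis
    unfolding bowen_cover_def using assms(3,4) fine by (intro exI[of _ \<P>]) auto
qed

lemma bowen_cover_empty: "0 \<le> k \<Longrightarrow> bowen_cover \<alpha> n \<epsilon> {} k"
  unfolding bowen_cover_def by (rule exI[of _ "{}"]) auto

lemma bowen_cover_Un:
  assumes "bowen_cover \<alpha> n \<epsilon> A k" "bowen_cover \<alpha> n \<epsilon> B l"
  shows "bowen_cover \<alpha> n \<epsilon> (A \<union> B) (k + l)"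
proof -
  obtain \<P> where "finite \<P>" "A \<subseteq> \<Union>\<P>" "real (card \<P>) \<le> k" "\<forall>P\<in>\<P>. bowen_fine \<alpha> n \<epsilon> P"
    using assms(1) unfolding bowen_cover_def by (elim exE conjE)
  moreover obtain \<Q> where "finite \<Q>" "B \<subseteq> \<Union>\<Q>" "real (card \<Q>) \<le> l" "\<forall>P\<in>\<Q>. bowen_fine \<alpha> n \<epsilon> P"
    using assms(2) unfolding bowen_cover_def by (elim exE conjE)
  ultimately show ?thesis
    unfolding bowen_cover_def using card_Un_le[of \<P> \<Q>]
    by (intro exI[of _ "\<P> \<union> \<Q>"]) auto
qed

text \<open>Pieces of the longer cover are indexed by pairs: a point of \<open>E\<close> followed
  for \<open>m\<close> steps, and the piece of \<open>B\<close> met at time \<open>m\<close>. Two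
  points within \<open>\<epsilon> / 2\<close> of the same \<open>e\<close> are within
  \<open>\<epsilon>\<close> of each other.\<close>

lemma bowen_cover_step:
  assumes E: "finite E" "\<And>x. x \<in> A \<Longrightarrow> \<exists>e\<in>E. \<forall>i<m. dist ((\<alpha> ^^ i) x) ((\<alpha> ^^ i) e) < \<epsilon> / 2"
    and AB: "\<And>x. x \<in> A \<Longrightarrow> (\<alpha> ^^ m) x \<in> B" and B: "bowen_cover \<alpha> n \<epsilon> B k"
  shows "bowen_cover \<alpha> (m + n) \<epsilon> A (real (card E) * k)"
proof -
  obtain \<P> where \<P>: "finite \<P>" "B \<subseteq> \<Union>\<P>" "real (card \<P>) \<le> k" "\<forall>P\<in>\<P>. bowen_fine \<alpha> n \<epsilon> P"
    using B unfolding bowen_cover_def by (elim exE conjE)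
  define Q where "Q = (\<lambda>(e, P). {x. (\<forall>i<m. dist ((\<alpha> ^^ i) x) ((\<alpha> ^^ i) e) < \<epsilon> / 2) \<and> (\<alpha> ^^ m) x \<in> P})"
  have "A \<subseteq> \<Union> (Q ` (E \<times> \<P>))"
  proof
    fix x assume "x \<in> A"
    then obtain e P where "e \<in> E" "\<forall>i<m. dist ((\<alpha> ^^ i) x) ((\<alpha> ^^ i) e) < \<epsilon> / 2" "P \<in> \<P>" "(\<alpha> ^^ m) x \<in> P"
      using E(2) AB \<P>(2) by blast
    then show "x \<in> \<Union> (Q ` (E \<times> \<P>))" by (intro UN_I[of "(e, P)"]) (auto simp: Q_def)
  qed
  moreover have "real (card (Q ` (E \<times> \<P>))) \<le> real (card E) * k"
  proof -
    have "card (Q ` (E \<times> \<P>)) \<le> card E * card \<P>"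
      using card_image_le[of "E \<times> \<P>" Q] E(1) \<P>(1) by (simp add: card_cartesian_product)
    then have "real (card (Q ` (E \<times> \<P>))) \<le> real (card E) * real (card \<P>)"
      by (metis of_nat_le_iff of_nat_mult)
    also have "\<dots> \<le> real (card E) * k" using \<P>(3) by (intro mult_left_mono) auto
    finally show ?thesis .
  qed
  moreover have "bowen_fine \<alpha> (m + n) \<epsilon> (Q (e, P))" if "P \<in> \<P>" for e P
    unfolding bowen_fine_def
  proof (intro ballI allI impI)
    fix x y i assume x: "x \<in> Q (e, P)" and y: "y \<in> Q (e, P)" and i: "i < m + n"
    show "dist ((\<alpha> ^^ i) x) ((\<alpha> ^^ i) y) < \<epsilon>"
    proof (cases "i < m")
      case True
      then have "dist ((\<alpha> ^^ i) x) ((\<alpha> ^^ i) e) < \<epsilon> / 2" "dist ((\<alpha> ^^ i) y) ((\<alpha> ^^ i) e) < \<epsilon> / 2"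
        using x y by (auto simp: Q_def)
      then show ?thesis by (rule dist_triangle_half_l)
    next
      case False
      then obtain j where j: "i = j + m" by (metis add.commute le_add_diff_inverse not_less)
      then show ?thesis
        using \<P>(4) that x y i by (auto simp: Q_def bowen_fine_def funpow_add)
    qed
  qed
  ultimately show ?thesis
    unfolding bowen_cover_def using E(1) \<P>(1)
    by (intro exI[of _ "Q ` (E \<times> \<P>)"]) auto
qed

lemma finite_net:
  assumes "compact (UNIV :: 'a::metric_space set)" "0 < e"
  obtains F :: "'a::metric_space set" where "finite F" "\<And>x. \<exists>f\<in>F. dist x f < e"
proof -
  obtain F :: "'a set" where F: "finite F" "UNIV \<subseteq> (\<Union>f\<in>F. ball f e)"
    by (rule compactE_image[OF assms(1), of UNIV "\<lambda>x. ball x e"]) (use assms(2) in auto)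
  show ?thesis
  proof
    show "\<exists>f\<in>F. dist x f < e" for x
      using F(2) by (metis UN_E UNIV_I dist_commute mem_ball subsetD)
  qed (rule F)
qed

text \<open>This crude bound, obtained one step at a time, serves for segments shorter than a
  block.\<close>

lemma bowen_cover_UNIV:
  fixes \<alpha> :: "'a::metric_space \<Rightarrow> 'a" and F :: "'a set"
  assumes "finite F" "\<And>x. \<exists>f\<in>F. dist x f < \<epsilon> / 2"
  shows "bowen_cover \<alpha> n \<epsilon> UNIV (real (card F) ^ n)"
proof (induction n)
  case 0
  show ?case unfolding bowen_cover_def bowen_fine_def by (rule exI[of _ "{UNIV}"]) auto
next
  case (Suc n)
  have "bowen_cover \<alpha> (1 + n) \<epsilon> UNIV (real (card F) * real (card F) ^ n)"
    by (rule bowen_cover_step[OF assms(1) _ _ Suc]) (use assms(2) in auto)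
  then show ?case by simp
qed

lemma bowen_dist_less_iff:
  assumes "0 < n"
  shows "bowen_dist \<alpha> n x y < \<epsilon> \<longleftrightarrow> (\<forall>i<n. dist ((\<alpha> ^^ i) x) ((\<alpha> ^^ i) y) < \<epsilon>)"
proof -
  have eq: "{0..n - 1} = {..<n}" using assms by auto
  have "(\<lambda>i. dist ((\<alpha> ^^ i) x) ((\<alpha> ^^ i) y)) ` {..<n} \<noteq> {}" using assms by auto
  then show ?thesis unfolding bowen_dist_def eq by (subst Max_less_iff) blast+
qed

lemma bowen_cover_imp_spanning:
  assumes "bowen_cover \<alpha> n \<epsilon> UNIV k" "0 < n"
  obtains E where "finite E" "spanning \<alpha> UNIV n \<epsilon> E" "real (card E) \<le> k"
proof -
  obtain \<P> where \<P>: "finite \<P>" "UNIV \<subseteq> \<Union>\<P>" "real (card \<P>) \<le> k" "\<forall>P\<in>\<P>. bowen_fine \<alpha> n \<epsilon> P"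
    using assms(1) unfolding bowen_cover_def by (elim exE conjE)
  show ?thesis
  \<comment> \<open>An empty piece contributes an arbitrary point, which is harmless because any
    point may belong to a set spanning \<open>UNIV\<close>.\<close>
  proof (rule that[of "(\<lambda>P. SOME x. x \<in> P) ` \<P>"])
    show "real (card ((\<lambda>P. SOME x. x \<in> P) ` \<P>)) \<le> k"
      using \<P>(1,3) card_image_le[OF \<P>(1)] by (meson of_nat_le_iff order_trans)
    show "spanning \<alpha> UNIV n \<epsilon> ((\<lambda>P. SOME x. x \<in> P) ` \<P>)"
      unfolding spanning_def
    proof (intro conjI ballI subset_UNIV)
      fix x
      obtain P where P: "P \<in> \<P>" "x \<in> P" using \<P>(2) by auto
      from P(2) have "(SOME x. x \<in> P) \<in> P" by (rule someI[of "\<lambda>x. x \<in> P"])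
      then have "bowen_dist \<alpha> n x (SOME x. x \<in> P) < \<epsilon>"
        using P \<P>(4) assms(2) by (auto simp: bowen_dist_less_iff bowen_fine_def)
      then show "\<exists>y\<in>(\<lambda>P. SOME x. x \<in> P) ` \<P>. bowen_dist \<alpha> n x y < \<epsilon>"
        using P(1) by auto
    qed
  qed (use \<P>(1) in auto)
qed

text \<open>A point of \<open>U\<close> is followed for \<open>m\<close> steps by one of the points of \<open>E\<close>, any other point
  for a single step by one of the points of \<open>F\<close>; the weight \<open>r\<close> is paid once per visit outside \<open>U\<close>.\<close>

lemma bowen_cover_few_visits:
  fixes \<alpha> :: "'a::metric_space \<Rightarrow> 'a" and F :: "'a set" and c r D \<epsilon> :: real
  assumes m: "0 < m" and c: "0 < c" and r: "1 \<le> r" and D: "0 \<le> D"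
    and short: "\<And>n. n < m \<Longrightarrow> bowen_cover \<alpha> n \<epsilon> UNIV (D * c ^ n)"
    and E: "finite E" "\<And>x. x \<in> U \<Longrightarrow> \<exists>e\<in>E. \<forall>i<m. dist ((\<alpha> ^^ i) x) ((\<alpha> ^^ i) e) < \<epsilon> / 2"
    and F: "finite F" "\<And>x. \<exists>f\<in>F. dist x f < \<epsilon> / 2"
    and balance: "real (card E) / c ^ m + real (card F) / (r * c) \<le> 1"
  shows "bowen_cover \<alpha> n \<epsilon> {x. card {i. i < n \<and> (\<alpha> ^^ i) x \<notin> U} \<le> b} (D * c ^ n * r ^ b)"
proof (induction n arbitrary: b rule: less_induct)
  case (less n)
  define A where "A n b = {x. card {i. i < n \<and> (\<alpha> ^^ i) x \<notin> U} \<le> b}" for n b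
  show ?case
  proof (cases "n < m")
    case True
    have "D * c ^ n * 1 \<le> D * c ^ n * r ^ b"
      using D c r by (intro mult_left_mono) auto
    then show ?thesis
      using short[OF True] by (auto intro: bowen_cover_mono)
  next
    case False
    \<comment> \<open>Skipping \<open>m\<close> steps cannot increase the number of remaining visits
      outside \<open>U\<close>, so the budget \<open>b\<close> is kept.\<close>
    have U: "bowen_cover \<alpha> (m + (n - m)) \<epsilon> (A n b \<inter> U) (real (card E) * (D * c ^ (n - m) * r ^ b))"
    proof (rule bowen_cover_step[OF E(1)])
      show "bowen_cover \<alpha> (n - m) \<epsilon> (A (n - m) b) (D * c ^ (n - m) * r ^ b)"
        unfolding A_def using m False by (intro less) auto
      show "(\<alpha> ^^ m) x \<in> A (n - m) b" if "x \<in> A n b \<inter> U" for x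
      proof -
        have "card {i. i < n - m \<and> (\<alpha> ^^ i) ((\<alpha> ^^ m) x) \<notin> U}
            = card ((\<lambda>i. i + m) ` {i. i < n - m \<and> (\<alpha> ^^ i) ((\<alpha> ^^ m) x) \<notin> U})"
          by (intro card_image[symmetric]) (auto simp: inj_on_def)
        also have "\<dots> \<le> card {i. i < n \<and> (\<alpha> ^^ i) x \<notin> U}"
          by (intro card_mono) (auto simp: funpow_add)
        finally show ?thesis using that by (auto simp: A_def)
      qed
    qed (use E(2) in auto)
    \<comment> \<open>Time 0 is itself a visit outside \<open>U\<close>: it uses one unit of the
      budget, whence the division by \<open>r\<close>, and it is impossible if
      \<open>b = 0\<close>.\<close>
    have nU: "bowen_cover \<alpha> (1 + (n - 1)) \<epsilon> (A n b - U) (real (card F) * (D * c ^ (n - 1) * (r ^ b / r)))"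
    proof (cases b)
      case 0
      have "A n b - U = {}"
        using m False 0 by (auto simp: A_def)
      show ?thesis unfolding \<open>A n b - U = {}\<close> using D c r by (intro bowen_cover_empty) auto
    next
      case (Suc b')
      show ?thesis
      proof (rule bowen_cover_step[OF F(1)])
        show "bowen_cover \<alpha> (n - 1) \<epsilon> (A (n - 1) b') (D * c ^ (n - 1) * (r ^ b / r))"
          using m False less[of "n - 1" b'] Suc r by (auto simp: A_def)
        show "(\<alpha> ^^ 1) x \<in> A (n - 1) b'" if "x \<in> A n b - U" for x
        proof -
          have "Suc (card {i. i < n - 1 \<and> (\<alpha> ^^ i) (\<alpha> x) \<notin> U})
              = card (insert 0 (Suc ` {i. i < n - 1 \<and> (\<alpha> ^^ i) (\<alpha> x) \<notin> U}))"
            by (subst card_insert_disjoint) (auto simp: card_image)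
          also have "\<dots> \<le> card {i. i < n \<and> (\<alpha> ^^ i) x \<notin> U}"
            using that m False by (intro card_mono) (auto simp: funpow_swap1)
          finally show ?thesis using that Suc by (auto simp: A_def)
        qed
      qed (use F(2) in auto)
    qed
    have "real (card E) * (D * c ^ (n - m) * r ^ b) + real (card F) * (D * c ^ (n - 1) * (r ^ b / r))
        = D * c ^ n * r ^ b * (real (card E) / c ^ m + real (card F) / (r * c))"
    proof -
      have "c ^ n = c ^ (n - m) * c ^ m" "c ^ n = c ^ (n - 1) * c"
        using m False by (simp_all flip: power_add power_Suc2)
      then have eq: "c ^ (n - m) = c ^ n / c ^ m" "c ^ (n - 1) = c ^ n / c"
        using c by (simp_all add: field_simps)
      have "e * (D * (x / p) * R) + f * (D * (x / c) * (R / r)) = D * x * R * (e / p + f / (r * c))"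
        for e f x p R :: real
        by (simp add: algebra_simps)
      then show ?thesis unfolding eq .
    qed
    also have "\<dots> \<le> D * c ^ n * r ^ b"
      using balance D c r by (intro mult_left_le) auto
    finally have le: "real (card E) * (D * c ^ (n - m) * r ^ b) + real (card F) * (D * c ^ (n - 1) * (r ^ b / r))
        \<le> D * c ^ n * r ^ b" .
    have "A n b = A n b \<inter> U \<union> (A n b - U)" by auto
    then have "bowen_cover \<alpha> n \<epsilon> (A n b)
        (real (card E) * (D * c ^ (n - m) * r ^ b) + real (card F) * (D * c ^ (n - 1) * (r ^ b / r)))"
      using bowen_cover_Un[of \<alpha> n \<epsilon> "A n b \<inter> U" _ "A n b - U"] U nU m False by simp
    with le show ?thesis unfolding A_def by (auto intro: bowen_cover_mono)
  qed
qed

text \<open>One time \<open>m\<close> with a small spanning set of the essential set controls all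
  long orbits of the space. The slack in \<open>card E < c ^ m\<close> allows a finite weight
  \<open>r\<close>, and visits outside \<open>U\<close> are rare enough for \<open>r ^ b\<close> to
  fit into the gap between \<open>c\<close> and \<open>d\<close>.\<close>

lemma spanning_essential_imp_spanning_UNIV:
  fixes \<alpha> :: "'a::metric_space \<Rightarrow> 'a" and c d \<epsilon> :: real
  assumes comp: "compact (UNIV :: 'a set)" and cont: "continuous_on UNIV \<alpha>"
    and m: "0 < m" and \<epsilon>: "0 < \<epsilon>" and c: "0 < c" "c < d"
    and E: "finite E" "spanning \<alpha> (essential_set \<alpha>) m (\<epsilon> / 4) E" "real (card E) < c ^ m"
  shows "eventually (\<lambda>n. \<exists>E. finite E \<and> spanning \<alpha> UNIV n \<epsilon> E \<and> real (card E) \<le> d ^ n) sequentially"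
proof -
  \<comment> \<open>Tolerance \<open>\<epsilon> / 4\<close> from \<open>x\<close> to an essential
    \<open>y\<close>, and again from \<open>y\<close> to \<open>E\<close>, leaves the
    \<open>\<epsilon> / 2\<close> that the covering argument asks for.\<close>
  define U where "U = (\<Union>y\<in>essential_set \<alpha>. \<Inter>i\<in>{..<m}. {x. dist ((\<alpha> ^^ i) x) ((\<alpha> ^^ i) y) < \<epsilon> / 4})"
  have cont_i: "continuous_on UNIV (\<alpha> ^^ i)" for i
  proof (induction i)
    case (Suc i)
    show ?case unfolding funpow.simps
      by (rule continuous_on_compose[OF Suc continuous_on_subset[OF cont subset_UNIV]])
  qed (simp add: id_def)
  have "open U"
    unfolding U_def
    by (intro open_UN ballI open_INT finite_lessThan open_Collect_less continuous_intros cont_i)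
  have "essential_set \<alpha> \<subseteq> U" using \<epsilon> by (auto simp: U_def)
  have EU: "\<exists>e\<in>E. \<forall>i<m. dist ((\<alpha> ^^ i) x) ((\<alpha> ^^ i) e) < \<epsilon> / 2" if x: "x \<in> U" for x
  proof -
    obtain y where y: "y \<in> essential_set \<alpha>" "\<forall>i<m. dist ((\<alpha> ^^ i) x) ((\<alpha> ^^ i) y) < \<epsilon> / 4"
      using x by (auto simp: U_def)
    obtain e where e: "e \<in> E" "\<forall>i<m. dist ((\<alpha> ^^ i) y) ((\<alpha> ^^ i) e) < \<epsilon> / 4"
      using E(2) y(1) unfolding spanning_def bowen_dist_less_iff[OF m] by blast
    have "dist ((\<alpha> ^^ i) x) ((\<alpha> ^^ i) e) < \<epsilon> / 2" if "i < m" for i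
      using dist_triangle[of "(\<alpha> ^^ i) x" "(\<alpha> ^^ i) e" "(\<alpha> ^^ i) y"] y(2) e(2) that by fastforce
    with e(1) show ?thesis by auto
  qed
  obtain F :: "'a set" where F: "finite F" "\<And>x. \<exists>f\<in>F. dist x f < \<epsilon> / 2"
    using finite_net[OF comp, of "\<epsilon> / 2"] \<epsilon> by auto
  define p q where "p = real (card E)" and "q = real (card F)"
  have gap: "1 - p / c ^ m > 0" using E(3) c by (simp add: p_def)
  \<comment> \<open>The weight is chosen so that \<open>q / (r * c)\<close> fits into the gap
    \<open>1 - p / c ^ m\<close>.\<close>
  define r where "r = max 1 (q / (c * (1 - p / c ^ m)))"
  have r: "1 \<le> r" by (simp add: r_def)
  have "q / (c * (1 - p / c ^ m)) \<le> r" by (simp add: r_def)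
  then have "q / (r * c) \<le> 1 - p / c ^ m"
    using gap c r by (simp add: divide_le_eq mult.commute mult.left_commute)
  then have balance: "real (card E) / c ^ m + real (card F) / (r * c) \<le> 1"
    by (simp add: p_def q_def)
  \<comment> \<open>The sum dominates each of its terms, so the crude cover is good enough for every
    length below \<open>m\<close>.\<close>
  define D where "D = (\<Sum>n<m. q ^ n / c ^ n)"
  have D: "0 \<le> D" unfolding D_def q_def using c by (intro sum_nonneg) auto
  have short: "bowen_cover \<alpha> n \<epsilon> UNIV (D * c ^ n)" if "n < m" for n
  proof (rule bowen_cover_mono[OF bowen_cover_UNIV[OF F]])
    have "q ^ n / c ^ n \<le> D"
      unfolding D_def q_def using that c by (intro member_le_sum) auto
    then show "real (card F) ^ n \<le> D * c ^ n"
      using c by (simp add: q_def divide_le_eq)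
  qed auto
  \<comment> \<open>This makes \<open>r powr \<delta> < d / c\<close>; the \<open>+ 1\<close> keeps
    the denominator positive when \<open>r = 1\<close>.\<close>
  define \<delta> where "\<delta> = ln (d / c) / (ln r + 1)"
  have ln: "0 < ln (d / c)" "0 \<le> ln r" using c r by auto
  then have \<delta>: "0 < \<delta>" "\<delta> * ln r < ln (d / c)"
    by (auto simp: \<delta>_def field_simps)
  \<comment> \<open>As \<open>s < 1\<close>, geometric decay eventually absorbs the constant
    \<open>D\<close>.\<close>
  define s where "s = c * r powr \<delta> / d"
  have "r powr \<delta> = exp (\<delta> * ln r)" using r by (simp add: powr_def)
  also have "\<dots> < exp (ln (d / c))" using \<delta>(2) by simp
  also have "\<dots> = d / c" using c by simp
  finally have s: "0 \<le> s" "s < 1" using c by (auto simp: s_def field_simps)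
  have "(\<lambda>n. D * s ^ n) \<longlonglongrightarrow> D * 0"
    using s by (intro tendsto_mult_left LIMSEQ_realpow_zero) auto
  then have "eventually (\<lambda>n. D * s ^ n < 1) sequentially"
    by (intro order_tendstoD(2)) auto
  with uniform_visit_frequency[OF comp cont \<open>open U\<close> \<open>essential_set \<alpha> \<subseteq> U\<close> \<delta>(1)] eventually_gt_at_top[of 0]
  show ?thesis
  proof eventually_elim
    case (elim n)
    define b where "b = nat \<lfloor>\<delta> * real n\<rfloor>"
    \<comment> \<open>Visit counts are integers, so rounding \<open>\<delta> * real n\<close> down
      excludes no point.\<close>
    have "{x. card {i. i < n \<and> (\<alpha> ^^ i) x \<notin> U} \<le> b} = UNIV"
      using elim(1) by (auto simp: b_def intro: le_nat_floor)
    then have cov: "bowen_cover \<alpha> n \<epsilon> UNIV (D * c ^ n * r ^ b)"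
      using bowen_cover_few_visits[OF m c(1) r D short E(1) EU F balance, where U = U and n = n and b = b] by simp
    have "real b \<le> \<delta> * real n" unfolding b_def using \<delta> by (intro of_nat_floor) auto
    then have "r powr real b \<le> r powr (\<delta> * real n)"
      using r by (rule powr_mono)
    also have "\<dots> = (r powr \<delta>) ^ n"
      using r powr_realpow[of "r powr \<delta>" n] unfolding powr_powr by simp
    also have "r powr real b = r ^ b"
      using r by (intro powr_realpow) simp
    finally have "r ^ b \<le> (r powr \<delta>) ^ n" .
    then have "D * c ^ n * r ^ b \<le> D * c ^ n * (r powr \<delta>) ^ n"
      using D c by (intro mult_left_mono) auto
    also have "\<dots> = D * s ^ n * d ^ n"
      using c by (simp add: s_def power_mult_distrib power_divide)
    also have "\<dots> \<le> 1 * d ^ n" using elim c by (intro mult_right_mono) auto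
    finally have "D * c ^ n * r ^ b \<le> d ^ n" by simp
    moreover obtain E where "finite E" "spanning \<alpha> UNIV n \<epsilon> E" "real (card E) \<le> D * c ^ n * r ^ b"
      using bowen_cover_imp_spanning[OF cov elim(2)] .
    ultimately show ?case by (intro exI[of _ E]) auto
  qed
qed

section \<open>Growth rates\<close>

text \<open>The weight \<open>w\<close> lets topological and forward entropy share one monotonicity
  argument in \<open>\<epsilon>\<close>.\<close>

definition span_rate :: "(nat \<Rightarrow> 'a set \<Rightarrow> ereal) \<Rightarrow> ('a::metric_space \<Rightarrow> 'a) \<Rightarrow> 'a set \<Rightarrow> real \<Rightarrow> ereal"
  where "span_rate w \<alpha> Y \<epsilon> = limsup (\<lambda>n. INF E\<in>{E. spanning \<alpha> Y n \<epsilon> E}. ereal_root n (w n E))"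

lemma spanning_mono: "spanning \<alpha> Y n \<epsilon> E \<Longrightarrow> \<epsilon> \<le> \<epsilon>' \<Longrightarrow> spanning \<alpha> Y n \<epsilon>' E"
  unfolding spanning_def by (meson less_le_trans)

lemma span_rate_antimono: "\<epsilon> \<le> \<epsilon>' \<Longrightarrow> span_rate w \<alpha> Y \<epsilon>' \<le> span_rate w \<alpha> Y \<epsilon>"
  unfolding span_rate_def
  by (intro Limsup_mono always_eventually allI INF_superset_mono) (auto intro: spanning_mono)

text \<open>\<open>Lim\<close> merely selects a limit, so convergence must be shown; monotone values
  approach their supremum.\<close>

lemma Lim_at_right_antimono:
  fixes f :: "real \<Rightarrow> ereal"
  assumes "\<And>x y. a < x \<Longrightarrow> x \<le> y \<Longrightarrow> f y \<le> f x"
  shows "Lim (at_right a) f = (SUP x\<in>{a<..}. f x)"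
proof (rule tendsto_Lim)
  show "(f \<longlongrightarrow> (SUP x\<in>{a<..}. f x)) (at_right a)"
  proof (rule order_tendstoI)
    fix l assume "l < (SUP x\<in>{a<..}. f x)"
    then obtain x where x: "a < x" "l < f x" by (auto simp: less_SUP_iff)
    have "l < f y" if "y \<in> {a<..<x}" for y
      using assms[of y x] x(2) that by (auto intro: less_le_trans)
    then show "eventually (\<lambda>y. l < f y) (at_right a)"
      by (rule eventually_mono[OF eventually_at_right_real[OF x(1)]])
  next
    fix u assume "(SUP x\<in>{a<..}. f x) < u"
    then show "eventually (\<lambda>y. f y < u) (at_right a)"
      by (intro eventually_mono[OF eventually_at_right_less])
         (auto intro: le_less_trans[OF SUP_upper])
  qed
qed simp

lemma topological_entropy_eq:
  "topological_entropy \<alpha> = ereal_ln (SUP \<epsilon>\<in>{0<..}. span_rate (\<lambda>n E. ecard E) \<alpha> UNIV \<epsilon>)"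
  unfolding topological_entropy_def span_rate_def[symmetric]
  by (subst Lim_at_right_antimono) (auto intro: span_rate_antimono)

lemma forward_entropy_eq:
  "forward_entropy \<alpha> =
    ereal_ln (SUP \<epsilon>\<in>{0<..}. span_rate (\<lambda>n E. ecard ((\<alpha> ^^ n) ` E)) \<alpha> (essential_set \<alpha>) \<epsilon>)"
  unfolding forward_entropy_def span_rate_def[symmetric]
  by (subst Lim_at_right_antimono) (auto intro: span_rate_antimono)

section \<open>Extended logarithms, roots and cardinalities\<close>

lemma ereal_ln_mono: "x \<le> y \<Longrightarrow> ereal_ln x \<le> ereal_ln y"
  by (cases x; cases y) (auto simp: ereal_ln_def)

lemma ereal_ln_eq_0_iff: "ereal_ln x = 0 \<longleftrightarrow> x = 1"
  by (cases x) (auto simp: ereal_ln_def one_ereal_def)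

lemma ecard_nonneg: "0 \<le> ecard A"
  by (simp add: ecard_def)

lemma ereal_root_nonneg: "0 \<le> x \<Longrightarrow> 0 \<le> ereal_root n x"
  by (cases x) (auto simp: ereal_root_def real_root_ge_zero)

lemma ereal_root_mono:
  assumes "0 < n" "x \<le> y" shows "ereal_root n x \<le> ereal_root n y"
  using assms by (cases x; cases y) (auto simp: ereal_root_def)

text \<open>Infinite sets have infinite \<open>ecard\<close>, so a finite bound on the root already
  forces finiteness.\<close>

lemma ereal_root_ecard_less:
  assumes "0 < n" "ereal_root n (ecard A) < ereal c"
  shows "finite A" "real (card A) < c ^ n"
proof -
  show fin: "finite A"
    using assms by (rule_tac ccontr) (simp add: ecard_def ereal_root_def)
  have "root n (real (card A)) < c"
    using assms fin by (simp add: ecard_def ereal_root_def)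
  then have "root n (real (card A)) ^ n < c ^ n"
    using assms(1) by (intro power_strict_mono) (auto simp: real_root_ge_zero)
  then show "real (card A) < c ^ n" using assms(1) by simp
qed

lemma span_rate_nonneg:
  assumes "\<And>n E. 0 \<le> w n E"
  shows "0 \<le> span_rate w \<alpha> Y \<epsilon>"
  unfolding span_rate_def
  by (intro le_Limsup always_eventually allI INF_greatest ereal_root_nonneg assms) simp

section \<open>Comparison of the three growth rates\<close>

lemma funpow_essential_set:
  fixes \<alpha> :: "'a::metric_space \<Rightarrow> 'a"
  assumes cont: "continuous_on UNIV \<alpha>" and x: "x \<in> essential_set \<alpha>"
  shows "(\<alpha> ^^ n) x \<in> essential_set \<alpha>"
proof (induction n)
  case 0
  then show ?case using x by simp
next
  case (Suc n)
  define y where "y = (\<alpha> ^^ n) x"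
  have "\<exists>\<mu>\<in>invariant_measures \<alpha>. measure \<mu> V > 0" if V: "open V" "\<alpha> y \<in> V" for V
  proof -
    \<comment> \<open>The preimage of \<open>V\<close> is a neighbourhood of \<open>y\<close>, and
      every invariant measure gives it the mass of \<open>V\<close>.\<close>
    have "open (\<alpha> -` V)" using cont V(1) by (simp add: continuous_on_open_vimage)
    then obtain \<mu> where \<mu>: "\<mu> \<in> invariant_measures \<alpha>" "measure \<mu> (\<alpha> -` V) > 0"
      using Suc V(2) unfolding essential_set_def y_def by auto
    then have "measure \<mu> (\<alpha> -` V) = measure \<mu> V"
      using V(1) by (auto simp: invariant_measures_def)
    with \<mu> show ?thesis by auto
  qed
  then show ?case by (simp add: essential_set_def y_def)
qed

text \<open>Points spanning the whole space may lie outside \<open>Y\<close>. Each is replaced by a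
  nearby point of \<open>Y\<close>, or dropped if there is none; this doubles the tolerance and does
  not increase the cardinality.\<close>

lemma forward_rate_le_topological_rate:
  fixes \<alpha> :: "'a::metric_space \<Rightarrow> 'a"
  shows "span_rate (\<lambda>n E. ecard ((\<alpha> ^^ n) ` E)) \<alpha> Y \<epsilon> \<le> span_rate (\<lambda>n E. ecard E) \<alpha> UNIV (\<epsilon> / 2)"
  unfolding span_rate_def
proof (rule Limsup_mono, rule eventually_mono[OF eventually_gt_at_top[of 0]])
  fix n :: nat assume n: "0 < n"
  show "(INF E\<in>{E. spanning \<alpha> Y n \<epsilon> E}. ereal_root n (ecard ((\<alpha> ^^ n) ` E)))
      \<le> (INF E\<in>{E. spanning \<alpha> UNIV n (\<epsilon> / 2) E}. ereal_root n (ecard E))"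
  proof (rule INF_mono, clarify)
    fix E assume E: "spanning \<alpha> UNIV n (\<epsilon> / 2) E"
    define N where "N e = {y\<in>Y. bowen_dist \<alpha> n y e < \<epsilon> / 2}" for e
    define E' where "E' = (\<lambda>e. SOME y. y \<in> N e) ` {e\<in>E. N e \<noteq> {}}"
    have N: "(SOME y. y \<in> N e) \<in> N e" if "N e \<noteq> {}" for e
      using that by (simp add: some_in_eq)
    have "spanning \<alpha> Y n \<epsilon> E'"
      unfolding spanning_def
    proof (intro conjI ballI)
      show "E' \<subseteq> Y" using N by (auto simp: E'_def N_def)
      fix x assume x: "x \<in> Y"
      then obtain e where e: "e \<in> E" "bowen_dist \<alpha> n x e < \<epsilon> / 2"
        using E by (auto simp: spanning_def)
      then have "N e \<noteq> {}" using x by (auto simp: N_def)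
      define y where "y = (SOME y. y \<in> N e)"
      have "y \<in> N e" unfolding y_def using \<open>N e \<noteq> {}\<close> by (rule N)
      then have y: "bowen_dist \<alpha> n y e < \<epsilon> / 2" by (simp add: N_def)
      have "bowen_dist \<alpha> n x y < \<epsilon>"
        using e(2) y unfolding bowen_dist_less_iff[OF n] by (blast intro: dist_triangle_half_l)
      moreover have "y \<in> E'" using e(1) \<open>N e \<noteq> {}\<close> by (auto simp: E'_def y_def)
      ultimately show "\<exists>y\<in>E'. bowen_dist \<alpha> n x y < \<epsilon>" by auto
    qed
    moreover have "ecard ((\<alpha> ^^ n) ` E') \<le> ecard E"
    proof (cases "finite E")
      case True
      then have "card ((\<alpha> ^^ n) ` E') \<le> card E'" "card E' \<le> card {e\<in>E. N e \<noteq> {}}"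
          "card {e\<in>E. N e \<noteq> {}} \<le> card E"
        by (auto simp: E'_def intro!: card_image_le card_mono)
      with True show ?thesis by (auto simp: ecard_def E'_def)
    qed (simp add: ecard_def)
    ultimately show "\<exists>E'\<in>{E. spanning \<alpha> Y n \<epsilon> E}. ereal_root n (ecard ((\<alpha> ^^ n) ` E')) \<le> ereal_root n (ecard E)"
      using n by (auto intro: ereal_root_mono)
  qed
qed

text \<open>Saturating a spanning set \<open>E\<close> to all essential points with the same image under
  \<open>\<alpha> ^^ n\<close> keeps \<open>(\<alpha> ^^ n) ` E\<close> and keeps it spanning.\<close>

lemma spanning_saturation:
  fixes \<alpha> :: "'a::metric_space \<Rightarrow> 'a" and g w :: real
  assumes cont: "continuous_on UNIV \<alpha>" and n: "0 < n" and w: "0 < w"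
    and E: "spanning \<alpha> (essential_set \<alpha>) n \<epsilon> E" "ereal_root n (ecard ((\<alpha> ^^ n) ` E)) < ereal g"
    and pre: "\<And>x. x \<in> essential_set \<alpha> \<Longrightarrow> ereal_root n (ecard (essential_preimage \<alpha> n x)) < ereal w"
  obtains E' where "finite E'" "spanning \<alpha> (essential_set \<alpha>) n \<epsilon> E'" "real (card E') < (g * w) ^ n"
proof
  define I where "I = (\<alpha> ^^ n) ` E"
  define E' where "E' = (\<Union>x\<in>I. essential_preimage \<alpha> n x)"
  have EY: "E \<subseteq> essential_set \<alpha>" using E(1) by (simp add: spanning_def)
  \<comment> \<open>The bound \<open>pre\<close> concerns essential points, so forward invariance is
    needed to apply it on \<open>I\<close>.\<close>
  have IY: "I \<subseteq> essential_set \<alpha>"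
    using EY funpow_essential_set[OF cont] by (auto simp: I_def)
  have I: "finite I" "real (card I) < g ^ n"
    using ereal_root_ecard_less[OF n E(2)] by (simp_all add: I_def)
  note P = ereal_root_ecard_less[OF n pre]
  show "finite E'" using I P IY by (auto simp: E'_def)
  have "E \<subseteq> E'" using EY by (auto simp: E'_def I_def essential_preimage_def)
  moreover have "E' \<subseteq> essential_set \<alpha>" by (auto simp: E'_def essential_preimage_def)
  ultimately show "spanning \<alpha> (essential_set \<alpha>) n \<epsilon> E'"
    using E(1) unfolding spanning_def by blast
  have "real (card E') \<le> real (\<Sum>x\<in>I. card (essential_preimage \<alpha> n x))"
    unfolding E'_def of_nat_le_iff using I(1) by (rule card_UN_le)
  also have "\<dots> = (\<Sum>x\<in>I. real (card (essential_preimage \<alpha> n x)))" by simp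
  also have "\<dots> \<le> (\<Sum>x\<in>I. w ^ n)"
    using P(2) IY by (intro sum_mono) (auto intro: less_imp_le)
  also have "\<dots> = real (card I) * w ^ n" by simp
  also have "\<dots> < g ^ n * w ^ n" using I(2) w by (intro mult_strict_right_mono) auto
  finally show "real (card E') < (g * w) ^ n" by (simp add: power_mult_distrib)
qed

lemma topological_rate_le:
  fixes \<alpha> :: "'a::metric_space \<Rightarrow> 'a" and g w d :: real
  assumes comp: "compact (UNIV :: 'a set)" and cont: "continuous_on UNIV \<alpha>"
    and g: "span_rate (\<lambda>n E. ecard ((\<alpha> ^^ n) ` E)) \<alpha> (essential_set \<alpha>) (\<epsilon> / 4) < ereal g"
    and w: "limsup (\<lambda>n. SUP x\<in>essential_set \<alpha>. ereal_root n (ecard (essential_preimage \<alpha> n x))) < ereal w"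
    and pos: "0 < g" "0 < w" "g * w < d" "0 < \<epsilon>"
  shows "span_rate (\<lambda>n E. ecard E) \<alpha> UNIV \<epsilon> \<le> ereal d"
proof -
  have "eventually (\<lambda>n. (INF E\<in>{E. spanning \<alpha> (essential_set \<alpha>) n (\<epsilon> / 4) E}.
      ereal_root n (ecard ((\<alpha> ^^ n) ` E))) < ereal g) sequentially"
    using g unfolding span_rate_def by (rule Limsup_lessD)
  moreover have "eventually (\<lambda>n. (SUP x\<in>essential_set \<alpha>.
      ereal_root n (ecard (essential_preimage \<alpha> n x))) < ereal w) sequentially"
    using w by (rule Limsup_lessD)
  ultimately have "eventually (\<lambda>n. (INF E\<in>{E. spanning \<alpha> (essential_set \<alpha>) n (\<epsilon> / 4) E}.
      ereal_root n (ecard ((\<alpha> ^^ n) ` E))) < ereal g \<and> (SUP x\<in>essential_set \<alpha>.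
      ereal_root n (ecard (essential_preimage \<alpha> n x))) < ereal w \<and> 0 < n) sequentially"
    using eventually_gt_at_top[of 0] by eventually_elim simp
  \<comment> \<open>One time at which both bounds hold is enough: saturation there gives fewer than
    \<open>(g * w) ^ m\<close> spanning points, and the covering argument extends this to all large
    \<open>n\<close>.\<close>
  then obtain m :: nat where m: "0 < m"
    and mg: "(INF E\<in>{E. spanning \<alpha> (essential_set \<alpha>) m (\<epsilon> / 4) E}.
      ereal_root m (ecard ((\<alpha> ^^ m) ` E))) < ereal g"
    and mw: "(SUP x\<in>essential_set \<alpha>. ereal_root m (ecard (essential_preimage \<alpha> m x))) < ereal w"
    by (auto dest: eventually_happens'[OF sequentially_bot])
  obtain E where E: "spanning \<alpha> (essential_set \<alpha>) m (\<epsilon> / 4) E"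
      "ereal_root m (ecard ((\<alpha> ^^ m) ` E)) < ereal g"
    using mg by (auto simp: INF_less_iff)
  have "ereal_root m (ecard (essential_preimage \<alpha> m x)) < ereal w" if "x \<in> essential_set \<alpha>" for x
    using SUP_upper[OF that] mw by (rule le_less_trans)
  then obtain E' where E': "finite E'" "spanning \<alpha> (essential_set \<alpha>) m (\<epsilon> / 4) E'"
      "real (card E') < (g * w) ^ m"
    using spanning_saturation[OF cont m pos(2) E] by metis
  have "eventually (\<lambda>n. \<exists>E. finite E \<and> spanning \<alpha> UNIV n \<epsilon> E \<and> real (card E) \<le> d ^ n) sequentially"
    using spanning_essential_imp_spanning_UNIV[OF comp cont m pos(4) _ pos(3) E'] pos by simp
  with eventually_gt_at_top[of 0]
  have "eventually (\<lambda>n. (INF E\<in>{E. spanning \<alpha> UNIV n \<epsilon> E}. ereal_root n (ecard E)) \<le> ereal d) sequentially"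
  proof eventually_elim
    case (elim n)
    then obtain E where E: "finite E" "spanning \<alpha> UNIV n \<epsilon> E" "real (card E) \<le> d ^ n" by auto
    have "0 \<le> d" using mult_pos_pos[OF pos(1,2)] pos(3) by simp
    then have "root n (real (card E)) \<le> d"
      using real_root_le_mono[OF elim(1) E(3)] elim(1) by (simp add: real_root_power_cancel)
    then show ?case
      using E by (intro INF_lower2[of E]) (auto simp: ecard_def ereal_root_def)
  qed
  then show ?thesis unfolding span_rate_def by (rule Limsup_bounded)
qed

theorem corollary8:
  fixes \<alpha> :: "'a::metric_space \<Rightarrow> 'a"
  assumes "compact (UNIV :: 'a set)"
    and "continuous_on UNIV \<alpha>"
    and "(SUP x\<in>essential_set \<alpha>. ecard (\<alpha> -` {x} \<inter> essential_set \<alpha>)) < \<infinity>"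
    and "inverse_rami_rate \<alpha> \<le> topological_entropy \<alpha>"
  shows "(inverse_rami_rate \<alpha> = 0 \<longrightarrow> topological_entropy \<alpha> = forward_entropy \<alpha>) \<and>
         (forward_entropy \<alpha> = 0 \<longrightarrow> topological_entropy \<alpha> = inverse_rami_rate \<alpha>)"
proof -
  define H where "H = (SUP \<epsilon>\<in>{0<..}. span_rate (\<lambda>n E. ecard E) \<alpha> UNIV \<epsilon>)"
  define G where "G = (SUP \<epsilon>\<in>{0<..}. span_rate (\<lambda>n E. ecard ((\<alpha> ^^ n) ` E)) \<alpha> (essential_set \<alpha>) \<epsilon>)"
  define W where "W = limsup (\<lambda>n. SUP x\<in>essential_set \<alpha>. ereal_root n (ecard (essential_preimage \<alpha> n x)))"
  have GH: "G \<le> H"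
    unfolding G_def
  proof (rule SUP_least)
    fix \<epsilon> :: real assume "\<epsilon> \<in> {0<..}"
    then have "span_rate (\<lambda>n E. ecard E) \<alpha> UNIV (\<epsilon> / 2) \<le> H"
      unfolding H_def by (intro SUP_upper) auto
    then show "span_rate (\<lambda>n E. ecard ((\<alpha> ^^ n) ` E)) \<alpha> (essential_set \<alpha>) \<epsilon> \<le> H"
      by (rule order_trans[OF forward_rate_le_topological_rate])
  qed
  have G0: "0 \<le> G"
    unfolding G_def by (rule SUP_upper2[of 1]) (auto intro!: span_rate_nonneg ecard_nonneg)
  \<comment> \<open>This is \<open>H \<le> G * W\<close> phrased with real numbers strictly above
    the rates, which avoids products of 0 and infinity.\<close>
  have upper: "H \<le> ereal d" if "G < ereal g" "W < ereal w" "0 < g" "0 < w" "g * w < d" for g w d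
    unfolding H_def
  proof (rule SUP_least)
    fix \<epsilon> :: real assume "\<epsilon> \<in> {0<..}"
    then have "\<epsilon> / 4 \<in> {0<..}" "0 < \<epsilon>" by auto
    have "span_rate (\<lambda>n E. ecard ((\<alpha> ^^ n) ` E)) \<alpha> (essential_set \<alpha>) (\<epsilon> / 4) \<le> G"
      unfolding G_def using \<open>\<epsilon> / 4 \<in> {0<..}\<close> by (rule SUP_upper)
    from le_less_trans[OF this that(1)]
    show "span_rate (\<lambda>n E. ecard E) \<alpha> UNIV \<epsilon> \<le> ereal d"
      using that(2) unfolding W_def
      by (rule topological_rate_le[OF assms(1,2) _ _ that(3-5) \<open>0 < \<epsilon>\<close>])
  qed
  \<comment> \<open>The factor \<open>b\<close> will lie above the rate equal to 1, and
    \<open>a\<close> above the other one.\<close>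
  have split: "\<exists>a b. x < a \<and> 1 < b \<and> a * b < y" if "0 \<le> x" "x < y" for x y :: real
  proof -
    define a where "a = (x + y) / 2"
    have a: "0 < a" "x < a" "a < y" using that by (auto simp: a_def)
    define b where "b = (1 + y / a) / 2"
    have "1 < b" using a by (simp add: b_def)
    moreover have "a * b = (a + y) / 2" using a by (simp add: b_def distrib_left)
    ultimately show ?thesis using a by (intro exI[of _ a] exI[of _ b]) simp
  qed
  have "H = G" if W: "W = 1"
  proof (rule antisym[OF _ GH], rule ccontr)
    assume "\<not> H \<le> G"
    then have "G < H" by simp
    then obtain z where z: "G < ereal z" "ereal z < H" using ereal_dense2 by blast
    obtain x where x: "G = ereal x" "0 \<le> x"
      using G0 z(1) by (cases G) auto
    have "x < z" using z(1) x(1) by simp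
    then obtain a b where "x < a" "1 < b" "a * b < z" using split[OF x(2)] by blast
    then have "H \<le> ereal z" using W x by (intro upper[of a b]) (auto simp: one_ereal_def)
    with z(2) show False by simp
  qed
  moreover have "H \<le> W" if G: "G = 1"
  proof (rule ccontr)
    assume "\<not> H \<le> W"
    moreover have "0 < H" using GH G by (auto intro: less_le_trans[of 0 1])
    \<comment> \<open>The maximum with 0 replaces \<open>W\<close>, which would be
      \<open>-\<infinity>\<close> if its suprema ran over an empty set, by a nonnegative value as
      \<open>split\<close> demands.\<close>
    ultimately have "max W 0 < H" by simp
    then obtain z where z: "max W 0 < ereal z" "ereal z < H" using ereal_dense2 by blast
    obtain x where x: "max W 0 = ereal x"
      using z(1) max.cobounded2[of 0 W] by (cases "max W 0") auto
    then have "0 \<le> x" using max.cobounded2[of 0 W] by simp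
    moreover have "x < z" using z(1) x by simp
    ultimately obtain a b where ab: "x < a" "1 < b" "a * b < z" using split by blast
    have "max W 0 < ereal a" using x ab(1) by simp
    then have "W < ereal a" by simp
    then have "H \<le> ereal z" using G ab \<open>0 \<le> x\<close>
      by (intro upper[of b a]) (auto simp: one_ereal_def mult.commute)
    with z(2) show False by simp
  qed
  moreover have "topological_entropy \<alpha> = ereal_ln H" "forward_entropy \<alpha> = ereal_ln G"
      "inverse_rami_rate \<alpha> = ereal_ln W"
    unfolding H_def G_def W_def topological_entropy_eq forward_entropy_eq inverse_rami_rate_def by auto
  \<comment> \<open>A logarithm vanishes exactly at rate 1. In the second case
    \<open>H \<le> W\<close> gives one inequality between the logarithms and \<open>assms(4)\<close>
    the other.\<close>
  ultimately show ?thesis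
    using assms(4) by (auto simp: ereal_ln_eq_0_iff intro: antisym ereal_ln_mono)
qed

end
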